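(* Let $c\in[0,1)$ and let $(\lambda_n)_{n\ge1}$ be a sequence of arrival rates with $\lambda_n\in(0,n)$ and $\lim_{n\to\infty}\frac{\lambda_n}{n}=c$. For each $n$, let $\pi_{n,t}$ be the distribution of the number of customers at time $t$ and $\nu_n$ the stationary distribution of the continuous-time $M/M/n$ queue with arrival rate $\lambda_n$ and service rate $1$. Then there exist $L_n>0$ (not depending on $t$ or $\pi_{n,0}$) with $\lim_{n\to\infty}L_n=1-c$ such that for every $n$ and every initial distribution $\pi_{n,0}$, $$\chi(\pi_{n,t},\nu_n)\le e^{-L_nt}\,\chi(\pi_{n,0},\nu_n)\qquad\forall t\ge0.$$
   Context: The $M/M/n$ queue with arrival rate $\lambda$ and service rate $1$ is the continuous-time birth-and-death Markov chain on $\mathbb Z_{\ge0}$ (state = number of customers) with birth rate $\lambda$ in every state and death rate $\min\{n,q\}$ in state $q$. For $0<\lambda<n$ it has a unique stationary distribution. For probability distributions $P,Q$ on a countable set $S$ with $P$ absolutely continuous with respect to $Q$, $\chi^2(P,Q)=\sum_{x\in S}\frac{(P(x)-Q(x))^2}{Q(x)}$ and $\chi(P,Q)=\sqrt{\chi^2(P,Q)}\in[0,\infty]$; if $\chi(\pi_{n,0},\nu_n)=\infty$ the bound is vacuous. *)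

theory Defs
  imports "HOL-Probability.Probability"
begin

text \<open>
  A continuous-time Markov chain is represented by its transition function: \<open>P t x\<close> is the law
  at time \<open>t\<close> of the chain started in \<open>x\<close>. Only \<open>t \<ge> 0\<close> matters. The right derivative of the
  transition probabilities at \<open>0\<close> is the generator \<open>q\<close> (off the diagonal, the jump rates).
\<close>
definition ctmc :: "('a \<Rightarrow> 'a \<Rightarrow> real) \<Rightarrow> (real \<Rightarrow> 'a \<Rightarrow> 'a pmf) \<Rightarrow> bool" where
  "ctmc q P \<longleftrightarrow>
     (\<forall>x. P 0 x = return_pmf x) \<and>
     (\<forall>s\<ge>0. \<forall>t\<ge>0. \<forall>x. P (s + t) x = bind_pmf (P s x) (P t)) \<and>
     (\<forall>x y. ((\<lambda>t. pmf (P t x) y) has_real_derivative q x y) (at_right 0))"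

definition law_at :: "(real \<Rightarrow> 'a \<Rightarrow> 'a pmf) \<Rightarrow> 'a pmf \<Rightarrow> real \<Rightarrow> 'a pmf" where
  "law_at P \<mu> t = bind_pmf \<mu> (P t)"

definition stationary :: "(real \<Rightarrow> 'a \<Rightarrow> 'a pmf) \<Rightarrow> 'a pmf \<Rightarrow> bool" where
  "stationary P \<nu> \<longleftrightarrow> (\<forall>t\<ge>0. law_at P \<nu> t = \<nu>)"

text \<open>
  The diagonal entries make the rows sum to \<open>0\<close>; the death rate in state \<open>0\<close> is \<open>min n 0 = 0\<close>.
\<close>
definition mmn_generator :: "nat \<Rightarrow> real \<Rightarrow> nat \<Rightarrow> nat \<Rightarrow> real" where
  "mmn_generator n r x y =
     (if y = x + 1 then r
      else if x = y + 1 then real (min n x)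
      else if x = y then - (r + real (min n x))
      else 0)"

text \<open>
  The quotient is taken in \<^typ>\<open>ennreal\<close>, where \<open>a / 0 = \<infinity>\<close> for \<open>a > 0\<close> and \<open>0 / 0 = 0\<close>. Hence
  the value is \<open>\<infinity>\<close> unless \<open>P\<close> is absolutely continuous with respect to \<open>Q\<close>.
\<close>
definition chi_sq :: "'a pmf \<Rightarrow> 'a pmf \<Rightarrow> ennreal" where
  "chi_sq P Q =
     (\<integral>\<^sup>+x. ennreal ((pmf P x - pmf Q x)\<^sup>2) / ennreal (pmf Q x) \<partial>count_space UNIV)"

definition chi :: "'a pmf \<Rightarrow> 'a pmf \<Rightarrow> ennreal" where
  "chi P Q = (if chi_sq P Q = \<infinity> then \<infinity> else ennreal (sqrt (enn2real (chi_sq P Q))))"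

end

theory Submission
  imports Defs
begin

text \<open>
  By duality the \<open>\<chi>\<close>-decay of the law follows from \<open>L\<^sup>2(\<nu>)\<close>-decay of \<open>u\<^sub>t = P\<^sub>t f\<close> for bounded
  \<open>f\<close> with \<open>\<nu>\<close>-mean \<open>0\<close>: test \<open>\<pi>\<^sub>t - \<nu>\<close> against a truncation of its own density. The rates are
  bounded, so \<open>u\<^sub>t\<close> is Lipschitz in \<open>t\<close> uniformly in the state and \<open>\<nu>(u\<^sub>t\<^sup>2)\<close> may be
  differentiated under the integral; its decay is then a Poincare inequality for \<open>\<nu>\<close>.
  A summation by parts turns the Poincare inequality into a Hardy inequality for the partial sums
  of \<open>\<nu> u\<close>, which holds with constant \<open>\<kappa>\<close> as soon as the birth rates
  \<open>b\<close> and death rates \<open>a\<close> admit weights \<open>d > 0\<close> with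
  \<open>(b\<^sub>k + a\<^sub>k\<^sub>+\<^sub>1) d\<^sub>k - a\<^sub>k d\<^sub>k\<^sub>-\<^sub>1 - b\<^sub>k\<^sub>+\<^sub>1 d\<^sub>k\<^sub>+\<^sub>1 \<ge> \<kappa> d\<^sub>k\<close>. For the queue, weights constant up to
  \<open>k = n - 1\<close> and growing like \<open>(1 + \<epsilon>)\<^sup>k\<close> afterwards give
  \<open>\<kappa> = min (1 - \<lambda> \<epsilon>) (\<epsilon> (n / (1 + \<epsilon>) - \<lambda>))\<close>, and \<open>\<epsilon> = 1 / n\<close> gives \<open>\<kappa> \<ge> n / (n + 1) - \<lambda> / n\<close>.
\<close>

section \<open>Monotonicity from right derivatives; expectations of bounded functions\<close>

text \<open>The transition functions come with right derivatives only, so the mean value theorem is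
  not at hand. If the claim failed, then after subtracting a small slope the last point where the
  tilted function is nonpositive would lie before \<open>b\<close>; but a negative right derivative
  there pushes the function further down.\<close>

lemma right_derivative_nonpos_imp_le:
  fixes f :: "real \<Rightarrow> real"
  assumes "a \<le> b" and cont: "continuous_on {a..b} f"
    and deriv: "\<And>t. a \<le> t \<Longrightarrow> t < b \<Longrightarrow> \<exists>D\<le>0. (f has_real_derivative D) (at_right t)"
  shows "f b \<le> f a"
proof (rule ccontr)
  assume "\<not> f b \<le> f a"
  then have gt: "f a < f b" by simp
  then have "a < b" using \<open>a \<le> b\<close> by (cases "a = b") auto
  \<comment> \<open>Half of the mean slope: positive, so that \<open>G\<close> has strictly negative
    right derivatives, yet small enough to keep \<open>G b\<close> positive.\<close>
  define e where "e = (f b - f a) / 2 / (b - a)"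
  have "e > 0" using gt \<open>a < b\<close> by (simp add: e_def)
  define G where "G t = f t - f a - e * (t - a)" for t
  have "e * (b - a) = (f b - f a) / 2" using \<open>a < b\<close> e_def
    by (metis less_irrefl nonzero_eq_divide_eq right_minus_eq)
  then have Gb: "G b > 0" using gt by (simp add: G_def)
  have contG: "continuous_on {a..b} G"
    unfolding G_def by (intro continuous_intros cont)
  define T where "T = {t \<in> {a..b}. G t \<le> 0}"
  have "compact T"
  proof -
    have "closed ({a..b} \<inter> G -` {..0})"
      by (rule continuous_closed_preimage[OF contG]) auto
    moreover have "T = {a..b} \<inter> G -` {..0}" by (auto simp: T_def)
    ultimately show ?thesis
      by (metis compact_Icc compact_Int_closed inf.left_idem)
  qed
  moreover have "a \<in> T" using \<open>a < b\<close> by (simp add: T_def G_def)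
  ultimately obtain s where s: "s \<in> T" and max: "\<And>t. t \<in> T \<Longrightarrow> t \<le> s"
    using compact_attains_sup[of T] by auto
  have sb: "a \<le> s" "s < b" "G s \<le> 0"
    using s Gb by (auto simp: T_def less_le)
  obtain D where D: "D \<le> 0" "(f has_real_derivative D) (at_right s)"
    using deriv sb by blast
  have "(G has_real_derivative (D - e)) (at_right s)"
    unfolding G_def by (auto intro!: derivative_eq_intros D)
  then obtain d where d: "d > 0" "\<And>h. 0 < h \<Longrightarrow> s + h \<in> {s<..} \<Longrightarrow> h < d \<Longrightarrow> G (s + h) < G s"
    using has_real_derivative_neg_dec_right[of G "D - e" s "{s<..}"] D \<open>e > 0\<close> by auto
  define h where "h = min (d / 2) (b - s)"
  have h: "0 < h" "h < d" "s + h \<le> b" using d sb by (auto simp: h_def)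
  have "G (s + h) < G s" using d(2)[of h] h by auto
  then have "s + h \<in> T" using h sb by (auto simp: T_def)
  from max[OF this] h show False by simp
qed

lemma expectation_bounded:
  fixes g :: "'a \<Rightarrow> real"
  assumes "\<And>y. \<bar>g y\<bar> \<le> B"
  shows "integrable (measure_pmf p) g" "\<bar>measure_pmf.expectation p g\<bar> \<le> B"
proof -
  show *: "integrable (measure_pmf p) g"
    by (rule measure_pmf.integrable_const_bound[where B = B]) (use assms in auto)
  have "\<bar>measure_pmf.expectation p g\<bar> \<le> measure_pmf.expectation p (\<lambda>y. \<bar>g y\<bar>)"
    by (rule integral_abs_bound)
  also have "\<dots> \<le> measure_pmf.expectation p (\<lambda>y. B)"
    by (rule integral_mono) (use * assms in auto)
  finally show "\<bar>measure_pmf.expectation p g\<bar> \<le> B" by simp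
qed

lemma integrable_square:
  fixes g :: "'a \<Rightarrow> real"
  assumes "\<And>y. \<bar>g y\<bar> \<le> B"
  shows "integrable (measure_pmf p) (\<lambda>x. (g x)\<^sup>2)"
proof (rule expectation_bounded)
  show "\<bar>(g y)\<^sup>2\<bar> \<le> B\<^sup>2" for y
    using power_mono[OF assms abs_ge_zero, of y 2] by simp
qed

lemma expectation_bind_pmf:
  fixes g :: "'b \<Rightarrow> real"
  assumes "\<And>y. \<bar>g y\<bar> \<le> B"
  shows "measure_pmf.expectation (bind_pmf p K) g
    = measure_pmf.expectation p (\<lambda>x. measure_pmf.expectation (K x) g)"
  unfolding measure_pmf_bind
  by (rule integral_bind[where K = "count_space UNIV" and B = B and B' = 1])
    (use assms in \<open>auto simp: measure_pmf_in_subprob_algebra intro!: AE_I2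
      measure_pmf.emeasure_le_1\<close>)

section \<open>Semigroup of a chain with bounded rates, up to its decay in L2\<close>

text \<open>Zero row sums over the finite set \<open>N x\<close> force the probability of being
  outside \<open>N x\<close> at time h to be o(h), so the entrywise derivatives determine the
  derivative on every bounded function. That \<open>M\<close> does not depend on the state later
  yields dominating constants under the integral.\<close>

locale bounded_ctmc =
  fixes q :: "'a \<Rightarrow> 'a \<Rightarrow> real" and P :: "real \<Rightarrow> 'a \<Rightarrow> 'a pmf"
    and N :: "'a \<Rightarrow> 'a set" and M :: real
  assumes ctmc: "ctmc q P"
    and finite_nbhd: "finite (N x)" and self_nbhd: "x \<in> N x"
    and conservative: "(\<Sum>y\<in>N x. q x y) = 0"
    and rate_bound: "(\<Sum>y\<in>N x. \<bar>q x y\<bar>) \<le> M"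
begin

definition semi :: "('a \<Rightarrow> real) \<Rightarrow> real \<Rightarrow> 'a \<Rightarrow> real" where
  "semi f t x = measure_pmf.expectation (P t x) f"

definition gen :: "('a \<Rightarrow> real) \<Rightarrow> 'a \<Rightarrow> real" where
  "gen f x = (\<Sum>y\<in>N x. q x y * f y)"

lemma P_0: "P 0 x = return_pmf x"
  using ctmc by (simp add: ctmc_def)

lemma P_add: "s \<ge> 0 \<Longrightarrow> t \<ge> 0 \<Longrightarrow> P (s + t) x = bind_pmf (P s x) (P t)"
  using ctmc by (simp add: ctmc_def)

lemma pmf_deriv_0: "((\<lambda>t. pmf (P t x) y) has_real_derivative q x y) (at_right 0)"
  using ctmc by (simp add: ctmc_def)

lemma semi_0: "semi f 0 x = f x"
  by (simp add: semi_def P_0)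

lemma semi_bound: "(\<And>y. \<bar>f y\<bar> \<le> B) \<Longrightarrow> \<bar>semi f t x\<bar> \<le> B"
  unfolding semi_def by (rule expectation_bounded)

lemma semi_add:
  assumes "\<And>y. \<bar>f y\<bar> \<le> B" "s \<ge> 0" "t \<ge> 0"
  shows "semi f (s + t) x = semi (semi f t) s x"
proof -
  have "semi f (s + t) x = measure_pmf.expectation (bind_pmf (P s x) (P t)) f"
    using assms by (simp add: semi_def P_add)
  also have "\<dots> = measure_pmf.expectation (P s x) (\<lambda>y. measure_pmf.expectation (P t y) f)"
    by (rule expectation_bind_pmf[where B = B]) (use assms in auto)
  finally show ?thesis by (simp add: semi_def[abs_def])
qed

lemma gen_bound:
  assumes "\<And>y. \<bar>f y\<bar> \<le> B"
  shows "\<bar>gen f x\<bar> \<le> M * B"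
proof -
  have "B \<ge> 0" using assms[of x] by linarith
  have "\<bar>gen f x\<bar> \<le> (\<Sum>y\<in>N x. \<bar>q x y\<bar> * \<bar>f y\<bar>)"
    unfolding gen_def by (rule order.trans[OF sum_abs]) (simp add: abs_mult)
  also have "\<dots> \<le> (\<Sum>y\<in>N x. \<bar>q x y\<bar> * B)"
    by (intro sum_mono mult_left_mono assms) auto
  also have "\<dots> \<le> M * B"
    using rate_bound[of x] \<open>B \<ge> 0\<close> by (simp add: mult_right_mono flip: sum_distrib_right)
  finally show ?thesis .
qed

text \<open>The part of \<open>f\<close> on \<open>N x\<close> is a finite sum and can be
  differentiated termwise. The remainder \<open>r\<close> is at most \<open>B\<close> times the
  escape probability \<phi>, whose right derivative at 0 is minus a row sum, hence 0.\<close>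

lemma semi_deriv_0:
  assumes bdd: "\<And>y. \<bar>f y\<bar> \<le> B"
  shows "((\<lambda>t. semi f t x) has_real_derivative gen f x) (at_right 0)"
proof -
  have "B \<ge> 0" using bdd[of x] by linarith
  define r where "r t = measure_pmf.expectation (P t x) (\<lambda>y. indicator (- N x) y * f y)" for t
  define \<phi> where "\<phi> t = 1 - (\<Sum>y\<in>N x. pmf (P t x) y)" for t
  have split: "semi f t x = (\<Sum>y\<in>N x. pmf (P t x) y * f y) + r t" for t
  proof -
    have "semi f t x = measure_pmf.expectation (P t x)
        (\<lambda>y. indicator (N x) y * f y + indicator (- N x) y * f y)"
      unfolding semi_def by (intro Bochner_Integration.integral_cong) (auto split: split_indicator)
    also have "\<dots> = measure_pmf.expectation (P t x) (\<lambda>y. indicator (N x) y * f y) + r t"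
      unfolding r_def
      by (intro Bochner_Integration.integral_add expectation_bounded[where B = B])
        (use bdd \<open>B \<ge> 0\<close> in \<open>auto split: split_indicator\<close>)
    also have "measure_pmf.expectation (P t x) (\<lambda>y. indicator (N x) y * f y)
        = (\<Sum>y\<in>N x. pmf (P t x) y * f y)"
      by (subst integral_measure_pmf[OF finite_nbhd[of x]]) (auto simp: indicator_eq_0_iff)
    finally show ?thesis .
  qed
  have r_le: "\<bar>r t\<bar> \<le> B * \<phi> t" for t
  proof -
    have "\<bar>r t\<bar> \<le> measure_pmf.expectation (P t x) (\<lambda>y. \<bar>indicator (- N x) y * f y\<bar>)"
      unfolding r_def by (rule integral_abs_bound)
    also have "\<dots> \<le> measure_pmf.expectation (P t x) (\<lambda>y. B * indicator (- N x) y)"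
      by (intro integral_mono expectation_bounded[where B = B])
        (use bdd \<open>B \<ge> 0\<close> in \<open>auto split: split_indicator\<close>)
    also have "\<dots> = B * measure_pmf.prob (P t x) (- N x)" by simp
    also have "measure_pmf.prob (P t x) (- N x) = \<phi> t"
      using measure_pmf.prob_compl[of "N x" "P t x"] finite_nbhd[of x]
      by (simp add: \<phi>_def measure_measure_pmf_finite Compl_eq_Diff_UNIV)
    finally show ?thesis .
  qed
  have \<phi>0: "\<phi> 0 = 0"
    using finite_nbhd[of x] self_nbhd[of x] by (simp add: \<phi>_def P_0 pmf_return indicator_def)
  have "(\<phi> has_real_derivative 0) (at_right 0)"
    unfolding \<phi>_def
    by (auto intro!: derivative_eq_intros pmf_deriv_0 simp: conservative)
  then have lim: "((\<lambda>t. \<phi> t / t) \<longlongrightarrow> 0) (at_right 0)"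
    by (simp add: has_field_derivative_iff \<phi>0)
  have r0: "r 0 = 0" using r_le[of 0] \<phi>0 by simp
  have "((\<lambda>t. B * (\<phi> t / t)) \<longlongrightarrow> 0) (at_right 0)"
    using tendsto_mult_left[OF lim, of B] by simp
  then have "((\<lambda>t. r t / t) \<longlongrightarrow> 0) (at_right 0)"
  proof (rule Lim_null_comparison[rotated])
    have "norm (r t / t) \<le> B * (\<phi> t / t)" if "t > 0" for t
      using r_le[of t] that by (simp add: divide_right_mono)
    then show "\<forall>\<^sub>F t in at_right 0. norm (r t / t) \<le> B * (\<phi> t / t)"
      by (auto simp: eventually_at_right_less eventually_at_filter)
  qed
  then have "(r has_real_derivative 0) (at_right 0)"
    by (simp add: has_field_derivative_iff r0)
  then show ?thesis
    unfolding split gen_def by (auto intro!: derivative_eq_intros pmf_deriv_0)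
qed

text \<open>By the Markov property, evolving \<open>f\<close> up to s > t means evolving
  \<open>semi f t\<close>, again bounded by \<open>B\<close>, for the time s - t. This reduces the
  claim to time 0 and gives the backward equation.\<close>

lemma semi_deriv:
  assumes bdd: "\<And>y. \<bar>f y\<bar> \<le> B" and "t \<ge> 0"
  shows "((\<lambda>s. semi f s x) has_real_derivative gen (semi f t) x) (at_right t)"
proof -
  have img: "(\<lambda>s. s - t) ` {t<..} = {0<..}"
    by (auto simp: image_iff intro!: bexI[of _ "_ + t"])
  have "((\<lambda>h. semi (semi f t) h x) has_real_derivative gen (semi f t) x)
      (at (t - t) within (\<lambda>s. s - t) ` {t<..})"
    unfolding img using semi_deriv_0[of "semi f t" B x] semi_bound[OF bdd] by simp
  moreover have "((\<lambda>s. s - t) has_real_derivative 1) (at_right t)"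
    by (auto intro!: derivative_eq_intros)
  ultimately have "((\<lambda>h. semi (semi f t) h x) \<circ> (\<lambda>s. s - t) has_real_derivative gen (semi f t) x * 1) (at_right t)"
    by (rule DERIV_image_chain)
  then
  have "((\<lambda>s. semi (semi f t) (s - t) x) has_real_derivative gen (semi f t) x) (at_right t)"
    by (simp add: o_def)
  moreover have "semi (semi f t) (s - t) x = semi f s x" if "s \<ge> t" for s
    using semi_add[of f B "s - t" t x, OF bdd] that \<open>t \<ge> 0\<close> by simp
  ultimately show ?thesis
    unfolding has_field_derivative_iff
    by (elim Lim_transform_eventually) (auto simp: eventually_at_filter semi_0)
qed

text \<open>Right derivatives give no continuity from the left. Splitting off the first t - s time
  units compares \<open>semi f s\<close> at a random state with its value at \<open>x\<close>; these
  differ only if that state is not \<open>x\<close>. The resulting modulus depends on t - s alone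
  and so serves both sides.\<close>

lemma semi_continuous:
  assumes bdd: "\<And>y. \<bar>f y\<bar> \<le> B"
  shows "continuous_on {0..} (\<lambda>t. semi f t x)"
proof -
  have "B \<ge> 0" using bdd[of x] by linarith
  define \<phi> where "\<phi> h = 2 * B * (1 - pmf (P h x) x)" for h
  have "((\<lambda>h. pmf (P h x) x) \<longlongrightarrow> 1) (at_right 0)"
    using DERIV_continuous[OF pmf_deriv_0[of x x]] by (simp add: continuous_within P_0)
  then have "(\<phi> \<longlongrightarrow> 2 * B * (1 - 1)) (at_right 0)"
    unfolding \<phi>_def by (intro tendsto_intros)
  then have lim: "(\<phi> \<longlongrightarrow> 0) (at_right 0)" by simp
  have diff: "\<bar>semi f t x - semi f s x\<bar> \<le> \<phi> (t - s)" if "0 \<le> s" "s \<le> t" for s t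
  proof -
    have "semi f t x = measure_pmf.expectation (P (t - s) x) (semi f s)"
      using semi_add[of f B "t - s" s x, OF bdd] that
      by (simp add: semi_def[of _ "t - s"])
    also have "\<dots> - semi f s x
        = measure_pmf.expectation (P (t - s) x) (\<lambda>y. semi f s y - semi f s x)"
      by (subst Bochner_Integration.integral_diff)
        (auto intro!: expectation_bounded(1)[where B = B] semi_bound bdd)
    finally have "\<bar>semi f t x - semi f s x\<bar>
        \<le> measure_pmf.expectation (P (t - s) x) (\<lambda>y. \<bar>semi f s y - semi f s x\<bar>)"
      using integral_abs_bound by simp
    also have "\<dots> \<le> measure_pmf.expectation (P (t - s) x) (\<lambda>y. 2 * B * indicator (- {x}) y)"
    proof (intro integral_mono expectation_bounded[where B = "2 * B"])
      have "\<bar>semi f s y - semi f s x\<bar> \<le> 2 * B" for y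
        using semi_bound[of f B s y, OF bdd] semi_bound[of f B s x, OF bdd] by linarith
      then show "\<bar>semi f s y - semi f s x\<bar> \<le> 2 * B * indicator (- {x}) y"
         "\<bar>\<bar>semi f s y - semi f s x\<bar>\<bar> \<le> 2 * B" for y
        by (auto split: split_indicator)
    qed (use \<open>B \<ge> 0\<close> in \<open>auto split: split_indicator\<close>)
    also have "\<dots> = \<phi> (t - s)"
      using measure_pmf.prob_compl[of "{x}" "P (t - s) x"]
      by (simp add: \<phi>_def pmf.rep_eq Compl_eq_Diff_UNIV)
    finally show ?thesis .
  qed
  show ?thesis
    unfolding continuous_on_iff
  proof (intro ballI allI impI)
    fix t e :: real assume "t \<in> {0..}" "0 < e"
    from lim \<open>0 < e\<close> have "\<forall>\<^sub>F h in at_right 0. \<phi> h < e"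
      by (rule order_tendstoD)
    then obtain d where d: "d > 0" "\<And>h. 0 < h \<Longrightarrow> h < d \<Longrightarrow> \<phi> h < e"
      by (auto simp: eventually_at_right_field)
    have "dist (semi f s x) (semi f t x) < e" if "s \<in> {0..}" "dist s t < d" for s
    proof (cases s t rule: linorder_cases)
      case less
      then show ?thesis
        using diff[of s t] d(2)[of "t - s"] that by (auto simp: dist_real_def)
    next
      case greater
      then show ?thesis
        using diff[of t s] d(2)[of "s - t"] that \<open>t \<in> {0..}\<close> by (auto simp: dist_real_def)
    qed (use \<open>0 < e\<close> in auto)
    then show "\<exists>d>0. \<forall>s\<in>{0..}. dist s t < d \<longrightarrow> dist (semi f s x) (semi f t x) < e"
      using \<open>d > 0\<close> by blast
  qed
qed

lemma semi_lipschitz: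
  assumes bdd: "\<And>y. \<bar>f y\<bar> \<le> B" and "0 \<le> s" "s \<le> t"
  shows "\<bar>semi f t x - semi f s x\<bar> \<le> M * B * (t - s)"
proof -
  have cont: "continuous_on {s..t} (\<lambda>r. semi f r x)"
    by (rule continuous_on_subset[OF semi_continuous[OF bdd]]) (use assms in auto)
  have gb: "\<bar>gen (semi f r) x\<bar> \<le> M * B" for r
    by (intro gen_bound semi_bound bdd)
  \<comment> \<open>The two signs give the upper and the lower bound on the increment.\<close>
  have "\<sigma> * semi f t x - M * B * t \<le> \<sigma> * semi f s x - M * B * s" if "\<sigma> \<in> {-1, 1}" for \<sigma>
  proof (rule right_derivative_nonpos_imp_le[where f = "\<lambda>r. \<sigma> * semi f r x - M * B * r"])
    fix r assume "s \<le> r" "r < t"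
    have "((\<lambda>r. \<sigma> * semi f r x - M * B * r) has_real_derivative
        \<sigma> * gen (semi f r) x - M * B) (at_right r)"
      by (auto intro!: derivative_eq_intros semi_deriv[OF bdd] simp: \<open>s \<le> r\<close> order.trans[OF \<open>0 \<le> s\<close>])
    moreover have "\<sigma> * gen (semi f r) x - M * B \<le> 0"
      using gb[of r] that by auto
    ultimately show "\<exists>D\<le>0. ((\<lambda>r. \<sigma> * semi f r x - M * B * r) has_real_derivative D) (at_right r)"
      by blast
  qed (use assms in \<open>auto intro!: continuous_intros cont\<close>)
  from this[of 1] this[of "-1"] show ?thesis by (auto simp: algebra_simps)
qed


lemma square_semi_lipschitz:
  assumes bdd: "\<And>y. \<bar>f y\<bar> \<le> B" and "0 \<le> s" "s \<le> t"
  shows "\<bar>(semi f t x)\<^sup>2 - (semi f s x)\<^sup>2\<bar> \<le> 2 * B * (M * B) * (t - s)"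
proof -
  have "\<bar>(semi f t x)\<^sup>2 - (semi f s x)\<^sup>2\<bar>
      = \<bar>semi f t x + semi f s x\<bar> * \<bar>semi f t x - semi f s x\<bar>"
    by (simp add: power2_eq_square square_diff_square_factored abs_mult)
  also have "\<dots> \<le> (2 * B) * (M * B * (t - s))"
  proof (rule mult_mono)
    show "\<bar>semi f t x + semi f s x\<bar> \<le> 2 * B"
      using semi_bound[of f B t x, OF bdd] semi_bound[of f B s x, OF bdd] by linarith
    then show "0 \<le> 2 * B" by linarith
  qed (use semi_lipschitz[of f B s t x, OF bdd] assms in auto)
  finally show ?thesis by (simp add: mult_ac)
qed

text \<open>The difference quotients are bounded by \<open>K\<close> uniformly in the state, and
  constants are integrable for a probability law, so dominated convergence moves the limit
  inside.\<close>

lemma square_integral_deriv: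
  assumes bdd: "\<And>y. \<bar>f y\<bar> \<le> B" and "t \<ge> 0"
  shows "((\<lambda>s. measure_pmf.expectation \<nu> (\<lambda>x. (semi f s x)\<^sup>2)) has_real_derivative
    2 * measure_pmf.expectation \<nu> (\<lambda>x. semi f t x * gen (semi f t) x)) (at_right t)"
proof -
  define V where "V s = measure_pmf.expectation \<nu> (\<lambda>x. (semi f s x)\<^sup>2)" for s
  define K where "K = 2 * B * (M * B)"
  have int: "integrable (measure_pmf \<nu>) (\<lambda>x. (semi f s x)\<^sup>2)" for s
    by (rule integrable_square[of "semi f s" B, OF semi_bound[of f B, OF bdd]])
  have "((\<lambda>s. (V s - V t) / (s - t)) \<longlongrightarrow>
      measure_pmf.expectation \<nu> (\<lambda>x. 2 * (semi f t x * gen (semi f t) x))) (at_right t)"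
    \<comment> \<open>Dominated convergence is used along sequences decreasing or otherwise
      converging to \<open>t\<close> from the right.\<close>
    unfolding tendsto_at_iff_sequentially
  proof (intro allI impI)
    fix X assume X: "\<forall>i. X i \<in> {t<..} - {t}" "X \<longlonglongrightarrow> t"
    define D where "D i x = ((semi f (X i) x)\<^sup>2 - (semi f t x)\<^sup>2) / (X i - t)" for i x
    have "((\<lambda>s. (V s - V t) / (s - t)) \<circ> X) = (\<lambda>i. measure_pmf.expectation \<nu> (D i))"
      by (auto simp: D_def[abs_def] V_def int)
    moreover have "(\<lambda>i. measure_pmf.expectation \<nu> (D i)) \<longlonglongrightarrow>
        measure_pmf.expectation \<nu> (\<lambda>x. 2 * (semi f t x * gen (semi f t) x))"
    proof (rule integral_dominated_convergence[where w = "\<lambda>_. K"])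
      show "AE x in measure_pmf \<nu>. (\<lambda>i. D i x) \<longlonglongrightarrow> 2 * (semi f t x * gen (semi f t) x)"
      proof (rule AE_I2)
        fix x
        have "((\<lambda>s. (semi f s x)\<^sup>2) has_real_derivative 2 * (semi f t x * gen (semi f t) x))
            (at_right t)"
          by (auto intro!: derivative_eq_intros semi_deriv[OF bdd] \<open>t \<ge> 0\<close>)
        then show "(\<lambda>i. D i x) \<longlonglongrightarrow> 2 * (semi f t x * gen (semi f t) x)"
          using X unfolding has_field_derivative_iff tendsto_at_iff_sequentially
          by (auto simp: D_def o_def)
      qed
      show "AE x in measure_pmf \<nu>. norm (D i x) \<le> K" for i
      proof (rule AE_I2)
        fix x
        have "X i > t" using X by auto
        then show "norm (D i x) \<le> K"
          using square_semi_lipschitz[of f B t "X i" x, OF bdd] \<open>t \<ge> 0\<close>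
          by (simp add: D_def K_def pos_divide_le_eq)
      qed
    qed auto
    ultimately show "((\<lambda>s. (V s - V t) / (s - t)) \<circ> X) \<longlonglongrightarrow>
        measure_pmf.expectation \<nu> (\<lambda>x. 2 * (semi f t x * gen (semi f t) x))"
      by simp
  qed
  then show ?thesis by (simp add: has_field_derivative_iff V_def)
qed

lemma square_integral_continuous:
  assumes bdd: "\<And>y. \<bar>f y\<bar> \<le> B"
  shows "continuous_on {0..} (\<lambda>t. measure_pmf.expectation \<nu> (\<lambda>x. (semi f t x)\<^sup>2))"
proof -
  define V where "V s = measure_pmf.expectation \<nu> (\<lambda>x. (semi f s x)\<^sup>2)" for s
  define K where "K = \<bar>2 * B * (M * B)\<bar>"
  have int: "integrable (measure_pmf \<nu>) (\<lambda>x. (semi f s x)\<^sup>2)" for s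
    by (rule integrable_square[of "semi f s" B, OF semi_bound[of f B, OF bdd]])
  have lip: "\<bar>V t - V s\<bar> \<le> K * (t - s)" if "0 \<le> s" "s \<le> t" for s t
  proof -
    have "V t - V s = measure_pmf.expectation \<nu> (\<lambda>x. (semi f t x)\<^sup>2 - (semi f s x)\<^sup>2)"
      by (simp add: V_def int)
    also have "\<bar>\<dots>\<bar> \<le> 2 * B * (M * B) * (t - s)"
      by (intro expectation_bounded square_semi_lipschitz bdd that)
    also have "\<dots> \<le> K * (t - s)"
      unfolding K_def using that by (intro mult_right_mono) auto
    finally show ?thesis .
  qed
  have "K-lipschitz_on {0..} V"
  proof (rule lipschitz_onI)
    fix s t :: real assume "s \<in> {0..}" "t \<in> {0..}"
    then show "dist (V s) (V t) \<le> K * dist s t"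
      using lip[of s t] lip[of t s] by (cases "s \<le> t") (auto simp: dist_real_def abs_minus_commute)
  qed (simp add: K_def)
  then show ?thesis
    using lipschitz_on_continuous_on V_def by (metis (no_types, lifting) ext)
qed

text \<open>A Gronwall argument. Stationarity keeps the mean at 0, so the Poincare inequality
  applies to \<open>semi f s\<close> at every time and makes the right derivative of
  \<open>exp (2 * \<kappa> * s) * V s\<close> nonpositive.\<close>

lemma L2_decay:
  assumes "stationary P \<nu>"
    and poincare: "\<And>v B. (\<And>y. \<bar>v y\<bar> \<le> B) \<Longrightarrow> measure_pmf.expectation \<nu> v = 0 \<Longrightarrow>
      \<kappa> * measure_pmf.expectation \<nu> (\<lambda>x. (v x)\<^sup>2) \<le> - measure_pmf.expectation \<nu> (\<lambda>x. v x * gen v x)"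
    and bdd: "\<And>y. \<bar>f y\<bar> \<le> B" and mean: "measure_pmf.expectation \<nu> f = 0" and "t \<ge> 0"
  shows "measure_pmf.expectation \<nu> (semi f t) = 0"
    and "measure_pmf.expectation \<nu> (\<lambda>x. (semi f t x)\<^sup>2)
      \<le> exp (- 2 * \<kappa> * t) * measure_pmf.expectation \<nu> (\<lambda>x. (f x)\<^sup>2)"
proof -
  have mean_t: "measure_pmf.expectation \<nu> (semi f s) = 0" if "s \<ge> 0" for s
    using expectation_bind_pmf[of f B \<nu> "P s", OF bdd] mean \<open>stationary P \<nu>\<close> that
    by (simp add: stationary_def law_at_def semi_def[abs_def])
  then show "measure_pmf.expectation \<nu> (semi f t) = 0" using \<open>t \<ge> 0\<close> .
  define V where "V s = measure_pmf.expectation \<nu> (\<lambda>x. (semi f s x)\<^sup>2)" for s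
  have "exp (2 * \<kappa> * t) * V t \<le> exp (2 * \<kappa> * 0) * V 0"
  proof (rule right_derivative_nonpos_imp_le[where f = "\<lambda>t. exp (2 * \<kappa> * t) * V t"])
    show "continuous_on {0..t} (\<lambda>t. exp (2 * \<kappa> * t) * V t)"
      unfolding V_def
      by (intro continuous_intros continuous_on_subset[OF square_integral_continuous[OF bdd]]) auto
    fix s assume s: "0 \<le> s" "s < t"
    let ?D = "exp (2 * \<kappa> * s) * (2 * (\<kappa> * V s + measure_pmf.expectation \<nu> (\<lambda>x. semi f s x * gen (semi f s) x)))"
    have "((\<lambda>t. exp (2 * \<kappa> * t) * V t) has_real_derivative ?D) (at_right s)"
      unfolding V_def
      by (auto intro!: derivative_eq_intros square_integral_deriv[OF bdd] s simp: algebra_simps)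
    moreover have "\<kappa> * V s + measure_pmf.expectation \<nu> (\<lambda>x. semi f s x * gen (semi f s) x) \<le> 0"
      using poincare[of "semi f s" B] semi_bound[of f B s, OF bdd] mean_t[OF s(1)]
      unfolding V_def by simp
    then have "?D \<le> 0" by (simp add: mult_nonneg_nonpos)
    ultimately show "\<exists>D\<le>0. ((\<lambda>t. exp (2 * \<kappa> * t) * V t) has_real_derivative D) (at_right s)"
      by blast
  qed (use \<open>t \<ge> 0\<close> in auto)
  then show "measure_pmf.expectation \<nu> (\<lambda>x. (semi f t x)\<^sup>2)
      \<le> exp (- 2 * \<kappa> * t) * measure_pmf.expectation \<nu> (\<lambda>x. (f x)\<^sup>2)"
    by (simp add: V_def semi_0 exp_minus field_simps)
qed

end

section \<open>From L2 decay to decay of the chi-square divergence\<close>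

lemma sums_expectation_nat:
  fixes g :: "nat \<Rightarrow> real"
  assumes "\<And>y. \<bar>g y\<bar> \<le> B"
  shows "(\<lambda>k. pmf p k * g k) sums measure_pmf.expectation p g"
proof -
  have "integrable (count_space UNIV) (\<lambda>k. pmf p k * g k)"
    using expectation_bounded(1)[of g B p, OF assms]
    by (simp add: measure_pmf_eq_density integrable_density)
  moreover have "measure_pmf.expectation p g = (\<integral>k. pmf p k * g k \<partial>count_space UNIV)"
    by (simp add: measure_pmf_eq_density integral_density)
  ultimately show ?thesis using sums_integral_count_space_nat by metis
qed

lemma ennreal_divide_pmf:
  assumes "pmf Q x > 0"
  shows "ennreal ((pmf R x - pmf Q x)\<^sup>2) / ennreal (pmf Q x) = ennreal ((pmf R x - pmf Q x)\<^sup>2 / pmf Q x)"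
  using assms by (simp add: divide_ennreal)

text \<open>Let Z be a partial sum of the divergence at time t and W the divergence at time 0.
  Testing against the truncated, centred density gives Z = \<pi>(v) with v the evolved test
  function. As \<nu>(v) = 0, Young's inequality yields 2 Z \<le> e W + \<nu>(v^2) / e, while L2
  decay yields \<nu>(v^2) \<le> e Z. Hence Z \<le> e W.\<close>

lemma chi_sq_decay:
  fixes q :: "nat \<Rightarrow> nat \<Rightarrow> real"
  assumes "bounded_ctmc q P N M" and stat: "stationary P \<nu>" and pos: "\<And>x. pmf \<nu> x > 0"
    and poincare: "\<And>v B. (\<And>y. \<bar>v y\<bar> \<le> B) \<Longrightarrow> measure_pmf.expectation \<nu> v = 0 \<Longrightarrow>
      \<kappa> * measure_pmf.expectation \<nu> (\<lambda>x. (v x)\<^sup>2)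
        \<le> - measure_pmf.expectation \<nu> (\<lambda>x. v x * bounded_ctmc.gen q N v x)"
    and "t \<ge> 0"
  shows "chi_sq (law_at P \<pi> t) \<nu> \<le> ennreal (exp (- 2 * \<kappa> * t)) * chi_sq \<pi> \<nu>"
proof (cases "chi_sq \<pi> \<nu> = \<infinity>")
  case True
  then show ?thesis by (simp add: ennreal_mult_top)
next
  case False
  interpret bounded_ctmc q P N M by fact
  define e where "e = exp (- 2 * \<kappa> * t)"
  have "e > 0" by (simp add: e_def)
  define w where "w x = (pmf \<pi> x - pmf \<nu> x)\<^sup>2 / pmf \<nu> x" for x
  have w0: "w x \<ge> 0" for x by (simp add: w_def)
  have chi_w: "chi_sq \<pi> \<nu> = (\<Sum>x. ennreal (w x))"
    unfolding chi_sq_def ennreal_divide_pmf[OF pos] nn_integral_count_space_nat w_def ..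
  then have sw: "summable w"
    using False w0 by (intro summable_suminf_not_top) auto
  have chi_w': "chi_sq \<pi> \<nu> = ennreal (\<Sum>x. w x)"
    unfolding chi_w by (rule suminf_ennreal2[OF w0 sw])
  define \<mu> where "\<mu> = law_at P \<pi> t"
  define z where "z x = (pmf \<mu> x - pmf \<nu> x)\<^sup>2 / pmf \<nu> x" for x
  have z0: "z x \<ge> 0" for x by (simp add: z_def)
  have "(\<Sum>x<n. z x) \<le> e * (\<Sum>x. w x)" for n
  proof -
    \<comment> \<open>The density of \<mu> - \<nu> with respect to \<nu>, cut off at
      \<open>n\<close> to make it bounded.\<close>
    define f where "f y = (if y < n then (pmf \<mu> y - pmf \<nu> y) / pmf \<nu> y else 0)" for y
    define B where "B = (\<Sum>y<n. \<bar>f y\<bar>)"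
    have fB: "\<bar>f y\<bar> \<le> B" for y
    proof (cases "y < n")
      case True
      then show ?thesis unfolding B_def by (intro member_le_sum) auto
    qed (auto simp: f_def B_def intro!: sum_nonneg)
    have expf: "measure_pmf.expectation p (\<lambda>y. f y * g y) = (\<Sum>y<n. pmf p y * (f y * g y))" for p g
      by (subst integral_measure_pmf[of "{..<n}"]) (auto simp: f_def split: if_splits)
    define m where "m = measure_pmf.expectation \<nu> f"
    \<comment> \<open>Truncation destroys the mean 0 that the decay estimate requires; subtracting
      \<open>m\<close> restores it.\<close>
    define g where "g y = f y - m" for y
    have gB: "\<bar>g y\<bar> \<le> B + \<bar>m\<bar>" for y
      unfolding g_def using fB[of y] abs_triangle_ineq4[of "f y" m] by linarith
    have expg: "measure_pmf.expectation p g = measure_pmf.expectation p f - m" for p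
      unfolding g_def
      by (subst Bochner_Integration.integral_diff) (auto intro: expectation_bounded(1)[OF fB])
    have g0: "measure_pmf.expectation \<nu> g = 0" by (simp add: expg m_def)
    note decay = L2_decay[OF stat poincare gB g0 \<open>t \<ge> 0\<close>]
    define v where "v = semi g t"
    have vB: "\<bar>v y\<bar> \<le> B + \<bar>m\<bar>" for y
      unfolding v_def by (rule semi_bound[OF gB])
    have z_eq: "(\<Sum>x<n. z x) = measure_pmf.expectation \<pi> v"
    proof -
      have "measure_pmf.expectation \<pi> v = measure_pmf.expectation \<mu> g"
        unfolding \<mu>_def law_at_def v_def semi_def[abs_def]
        by (rule expectation_bind_pmf[OF gB, symmetric])
      also have "\<dots> = (\<Sum>y<n. pmf \<mu> y * f y) - (\<Sum>y<n. pmf \<nu> y * f y)"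
        using expf[of _ "\<lambda>_. 1"] by (simp add: expg m_def)
      also have "\<dots> = (\<Sum>x<n. z x)"
        unfolding sum_subtractf[symmetric]
        by (intro sum.cong) (auto simp: f_def z_def power2_eq_square algebra_simps diff_divide_distrib add_divide_distrib)
      finally show ?thesis ..
    qed
    have "measure_pmf.expectation \<nu> (\<lambda>x. (v x)\<^sup>2) \<le> e * measure_pmf.expectation \<nu> (\<lambda>x. (g x)\<^sup>2)"
      unfolding v_def e_def by (rule decay(2))
    \<comment> \<open>A variance is at most the second moment, and the second moment of
      \<open>f\<close> is the partial sum itself.\<close>
    also have "measure_pmf.expectation \<nu> (\<lambda>x. (g x)\<^sup>2) \<le> (\<Sum>x<n. z x)"
    proof -
      note ints = integrable_square[of f B, OF fB] expectation_bounded(1)[of f B, OF fB]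
      have "measure_pmf.expectation \<nu> (\<lambda>x. (g x)\<^sup>2)
          = measure_pmf.expectation \<nu> (\<lambda>x. (f x)\<^sup>2 - 2 * m * f x + m\<^sup>2)"
        unfolding g_def by (intro Bochner_Integration.integral_cong) (auto simp: power2_eq_square algebra_simps)
      also have "\<dots> = measure_pmf.expectation \<nu> (\<lambda>x. (f x)\<^sup>2) - m\<^sup>2"
        by (simp add: ints m_def[symmetric]) (simp add: power2_eq_square)
      also have "\<dots> \<le> (\<Sum>y<n. pmf \<nu> y * (f y * f y))"
        using expf[of \<nu> f] by (simp add: power2_eq_square)
      also have "\<dots> = (\<Sum>x<n. z x)"
        using pos by (intro sum.cong) (auto simp: f_def z_def power2_eq_square less_imp_neq)
      finally show ?thesis .
    qed
    finally have V: "measure_pmf.expectation \<nu> (\<lambda>x. (v x)\<^sup>2) / e \<le> (\<Sum>x<n. z x)"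
      using \<open>e > 0\<close> by (simp add: pos_divide_le_eq mult.commute)
    have v2B: "\<bar>(v y)\<^sup>2\<bar> \<le> (B + \<bar>m\<bar>)\<^sup>2" for y
      using power_mono[OF vB abs_ge_zero, of y 2] by simp
    have v0: "measure_pmf.expectation \<nu> v = 0"
      unfolding v_def by (rule decay(1))
    note sums_v = sums_expectation_nat[of v "B + \<bar>m\<bar>", OF vB]
    \<comment> \<open>Since \<open>v\<close> has \<nu>-mean 0, the pairing with \<pi> equals the
      pairing with \<pi> - \<nu>, which is what \<open>w\<close> controls.\<close>
    have "(\<lambda>x. 2 * (pmf \<pi> x * v x - pmf \<nu> x * v x)) sums (2 * (measure_pmf.expectation \<pi> v - 0))"
      using sums_mult[OF sums_diff[OF sums_v[of \<pi>] sums_v[of \<nu>]], of 2] unfolding v0 .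
    moreover have "(\<lambda>x. e * w x + pmf \<nu> x * (v x)\<^sup>2 / e) sums
        (e * (\<Sum>x. w x) + measure_pmf.expectation \<nu> (\<lambda>x. (v x)\<^sup>2) / e)"
      by (intro sums_add sums_mult sums_divide summable_sums sw sums_expectation_nat[of _ "(B + \<bar>m\<bar>)\<^sup>2"] v2B)
    \<comment> \<open>The weight \<open>e\<close> is the L2 decay factor, so that the last term is
      absorbed by \<open>V\<close>.\<close>
    moreover have "2 * (pmf \<pi> x * v x - pmf \<nu> x * v x) \<le> e * w x + pmf \<nu> x * (v x)\<^sup>2 / e" for x
    proof -
      have "0 \<le> (e * (pmf \<pi> x - pmf \<nu> x) - pmf \<nu> x * v x)\<^sup>2 / (e * pmf \<nu> x)"
        using \<open>e > 0\<close> by simp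
      also have "\<dots> = e * w x + pmf \<nu> x * (v x)\<^sup>2 / e - 2 * (pmf \<pi> x * v x - pmf \<nu> x * v x)"
        using \<open>e > 0\<close> pos[of x] by (simp add: w_def field_simps power2_eq_square)
      finally show ?thesis by simp
    qed
    ultimately have "2 * (measure_pmf.expectation \<pi> v - 0)
        \<le> e * (\<Sum>x. w x) + measure_pmf.expectation \<nu> (\<lambda>x. (v x)\<^sup>2) / e"
      by (rule sums_le[rotated])
    with V z_eq show ?thesis by simp
  qed
  then have "(\<Sum>x<n. ennreal (z x)) \<le> ennreal (e * (\<Sum>x. w x))" for n
    by (simp add: sum_ennreal z0 ennreal_leI)
  then have "(\<Sum>x. ennreal (z x)) \<le> ennreal (e * (\<Sum>x. w x))"
    by (intro suminf_le_const) auto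
  moreover have "chi_sq \<mu> \<nu> = (\<Sum>x. ennreal (z x))"
    unfolding chi_sq_def ennreal_divide_pmf[OF pos] nn_integral_count_space_nat z_def ..
  moreover have "ennreal (e * (\<Sum>x. w x)) = ennreal e * chi_sq \<pi> \<nu>"
    unfolding chi_w' using \<open>e > 0\<close> suminf_nonneg[OF sw w0] by (intro ennreal_mult) auto
  ultimately show ?thesis by (simp only: e_def \<mu>_def)
qed

lemma chi_le_of_chi_sq_le:
  assumes "chi_sq \<mu> \<nu> \<le> ennreal ((exp a)\<^sup>2) * chi_sq \<pi> \<nu>"
  shows "chi \<mu> \<nu> \<le> ennreal (exp a) * chi \<pi> \<nu>"
proof (cases "chi_sq \<pi> \<nu> = \<infinity>")
  case True
  then show ?thesis by (simp add: chi_def ennreal_mult_top)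
next
  case False
  define X where "X = enn2real (chi_sq \<pi> \<nu>)"
  have X: "chi_sq \<pi> \<nu> = ennreal X" "X \<ge> 0"
    using False by (auto simp: X_def less_top)
  have le: "chi_sq \<mu> \<nu> \<le> ennreal ((exp a)\<^sup>2 * X)"
    using assms X by (simp add: ennreal_mult)
  then have fin: "chi_sq \<mu> \<nu> \<noteq> \<infinity>"
    by (auto simp: top_unique)
  have "enn2real (chi_sq \<mu> \<nu>) \<le> (exp a)\<^sup>2 * X"
    using enn2real_mono[OF le] X by simp
  then have "sqrt (enn2real (chi_sq \<mu> \<nu>)) \<le> exp a * sqrt X"
    using real_sqrt_le_mono by (fastforce simp: real_sqrt_mult)
  then show ?thesis
    using False fin X by (simp add: chi_def X_def[symmetric] ennreal_leI flip: ennreal_mult)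
qed

section \<open>Hardy and Poincare inequalities for birth-death weights\<close>

text \<open>\<open>\<nu> k * (u k)\<^sup>2\<close> is the squared increment of \<open>S\<close>
  divided by \<open>\<nu> k\<close>. The boundary term is carried along to close the induction: each
  step trades it for the next one, and \<open>super\<close> says that the two contributions to the
  coefficient of \<open>R N\<close> add up to at least \<kappa>.\<close>

lemma hardy_partial:
  fixes \<nu> u d a b :: "nat \<Rightarrow> real"
  defines "S \<equiv> \<lambda>k. \<Sum>j<k. \<nu> j * u j"
  defines "R \<equiv> \<lambda>k. (S (Suc k))\<^sup>2 / (b k * \<nu> k)"
  assumes \<nu>: "\<And>k. \<nu> k > 0" and b: "\<And>k. b k > 0" and "a 0 = 0"
    and db: "\<And>k. b k * \<nu> k = a (Suc k) * \<nu> (Suc k)"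
    and d: "\<And>k. d k > 0"
    and super: "\<And>k. \<kappa> * d k \<le> (b k + a (Suc k)) * d k - a k * d (k - 1) - b (Suc k) * d (Suc k)"
  shows "\<kappa> * (\<Sum>k<N. R k) + R N * (b N - a N * d (N - 1) / d N) \<le> (\<Sum>k<Suc N. \<nu> k * (u k)\<^sup>2)"
proof (induction N)
  case 0
  \<comment> \<open>Here equality holds; \<open>d (0 - 1)\<close> is \<open>d 0\<close> by truncated
    subtraction, and \<open>a 0 = 0\<close> removes it.\<close>
  show ?case using \<nu>[of 0] b[of 0] \<open>a 0 = 0\<close>
    by (simp add: R_def S_def power2_eq_square field_simps)
next
  case (Suc N)
  let ?n = "\<nu> (Suc N)" and ?a = "a (Suc N)" and ?b = "b (Suc N)" and ?d = "d N" and ?D = "d (Suc N)"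
  have R0: "R k \<ge> 0" for k using \<nu>[of k] b[of k] by (simp add: R_def less_imp_le)
  have a: "?a > 0"
    using db[of N] \<nu>[of "Suc N"] b[of N] \<nu>[of N] by (metis mult_pos_pos zero_less_mult_pos2)
  \<comment> \<open>The cross term of \<open>(S (k + 1) - S k)\<^sup>2\<close> is split by AM-GM with the ratio \<open>s\<close> that is sharp
    for \<open>S (k + 1) = b k * \<nu> k * d k\<close>.\<close>
  define s where "s = ?a * ?d / (?b * ?D)"
  have s: "s > 0" using a b d by (simp add: s_def)
  let ?x = "S (Suc (Suc N))" and ?y = "S (Suc N)"
  have "2 * ?x * ?y \<le> s * ?x\<^sup>2 + ?y\<^sup>2 / s"
  proof -
    have "0 \<le> (s * ?x - ?y)\<^sup>2 / s" using s by simp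
    also have "\<dots> = s * ?x\<^sup>2 + ?y\<^sup>2 / s - 2 * ?x * ?y"
      using s by (simp add: field_simps power2_eq_square)
    finally show ?thesis by simp
  qed
  then have "?x\<^sup>2 * (1 - s) / ?n + ?y\<^sup>2 * (1 - 1 / s) / ?n \<le> (?x - ?y)\<^sup>2 / ?n"
    unfolding add_divide_distrib[symmetric] using \<nu>[of "Suc N"]
    by (intro divide_right_mono) (auto simp: algebra_simps power2_eq_square)
  also have "(?x - ?y)\<^sup>2 / ?n = ?n * (u (Suc N))\<^sup>2"
    using \<nu>[of "Suc N"] by (simp add: S_def power2_eq_square)
  also have "?x\<^sup>2 * (1 - s) / ?n = R (Suc N) * (?b - ?a * ?d / ?D)"
    using \<nu>[of "Suc N"] b[of "Suc N"] d[of "Suc N"] by (simp add: R_def s_def field_simps)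
  also have "?y\<^sup>2 * (1 - 1 / s) / ?n = R N * (?a - ?b * ?D / ?d)"
    unfolding R_def db s_def
    using \<nu>[of "Suc N"] a b[of "Suc N"] d[of N] d[of "Suc N"] by (simp add: field_simps)
  finally have step: "R (Suc N) * (?b - ?a * ?d / ?D) + R N * (?a - ?b * ?D / ?d) \<le> ?n * (u (Suc N))\<^sup>2" .
  have "\<kappa> \<le> (b N - a N * d (N - 1) / d N) + (?a - ?b * ?D / ?d)"
  proof -
    have "\<kappa> \<le> ((b N + ?a) * ?d - a N * d (N - 1) - ?b * ?D) / ?d"
      using super[of N] d[of N] by (simp add: pos_le_divide_eq)
    also have "\<dots> = (b N - a N * d (N - 1) / d N) + (?a - ?b * ?D / ?d)"
      using d[of N] by (simp add: diff_divide_distrib)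
    finally show ?thesis .
  qed
  from mult_left_mono[OF this R0[of N]] Suc.IH step show ?case
    by (simp add: algebra_simps)
qed

lemma young_inequality_sqr:
  fixes s w x y :: real
  assumes "s > 0" "w > 0"
  shows "- (x * y) \<le> s / 2 * (x\<^sup>2 / w) + w * y\<^sup>2 / (2 * s)"
proof -
  have "(s * x + w * y)\<^sup>2 / (2 * s * w) = s / 2 * (x\<^sup>2 / w) + w * y\<^sup>2 / (2 * s) + x * y"
    using assms by (simp add: power2_sum add_divide_distrib power_mult_distrib)
      (simp add: power2_eq_square)
  moreover have "0 \<le> (s * x + w * y)\<^sup>2 / (2 * s * w)"
    using assms by simp
  ultimately show ?thesis by linarith
qed

text \<open>Summation by parts and Young's inequality with parameter \<kappa> bound \<open>U\<close>
  by half of the Hardy sum, which is at most \<open>U / 2\<close>, plus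
  \<open>E / (2 * \<kappa>)\<close>. The boundary terms vanish by \<open>Su\<close> and by
  \<open>R0\<close>, with \<open>down\<close> bounding the coefficient of the latter. In the
  application, mean 0 of \<open>u\<close> enters through these two limits.\<close>

lemma birth_death_poincare:
  fixes \<nu> u d a b :: "nat \<Rightarrow> real"
  defines "S \<equiv> \<lambda>k. \<Sum>j<k. \<nu> j * u j"
  assumes \<nu>: "\<And>k. \<nu> k > 0" and b: "\<And>k. b k > 0" and "a 0 = 0"
    and db: "\<And>k. b k * \<nu> k = a (Suc k) * \<nu> (Suc k)"
    and d: "\<And>k. d k > 0"
    and super: "\<And>k. \<kappa> * d k \<le> (b k + a (Suc k)) * d k - a k * d (k - 1) - b (Suc k) * d (Suc k)"
    and "\<kappa> > 0"
    and down: "\<And>k. a k * d (k - 1) \<le> A * d k"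
    and R0: "(\<lambda>k. (S (Suc k))\<^sup>2 / (b k * \<nu> k)) \<longlonglongrightarrow> 0"
    and Su: "(\<lambda>k. S k * u k) \<longlonglongrightarrow> 0"
    and U: "(\<lambda>k. \<nu> k * (u k)\<^sup>2) sums U"
    and E: "(\<lambda>k. b k * \<nu> k * (u (Suc k) - u k)\<^sup>2) sums E"
  shows "\<kappa> * U \<le> E"
proof -
  define R where "R k = (S (Suc k))\<^sup>2 / (b k * \<nu> k)" for k
  have Rpos: "R k \<ge> 0" for k using \<nu>[of k] b[of k] by (simp add: R_def less_imp_le)
  define UP where "UP N = (\<Sum>k<N. \<nu> k * (u k)\<^sup>2)" for N
  define EP where "EP N = (\<Sum>k<N. b k * \<nu> k * (u (Suc k) - u k)\<^sup>2)" for N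
  have hardy: "\<kappa> * (\<Sum>k<N. R k) \<le> UP (Suc N) + R N * A" for N
  proof -
    have "\<kappa> * (\<Sum>k<N. R k) + R N * (b N - a N * d (N - 1) / d N) \<le> UP (Suc N)"
      unfolding R_def S_def UP_def
      by (rule hardy_partial[of \<nu> b a d \<kappa> u N, OF \<nu> b \<open>a 0 = 0\<close> db d super])
    moreover have "- A \<le> b N - a N * d (N - 1) / d N"
    proof -
      have "a N * d (N - 1) / d N \<le> A"
        using down[of N] d[of N] by (simp add: pos_divide_le_eq)
      then show ?thesis using b[of N] by simp
    qed
    from mult_left_mono[OF this Rpos[of N]] have "- (R N * A) \<le> R N * (b N - a N * d (N - 1) / d N)"
      by simp
    ultimately show ?thesis by linarith
  qed
  have parts: "UP N = S N * u N - (\<Sum>k<N. S (Suc k) * (u (Suc k) - u k))" for N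
    by (induction N) (auto simp: UP_def S_def algebra_simps power2_eq_square)
  have young: "- (S (Suc k) * (u (Suc k) - u k)) \<le> \<kappa> / 2 * R k + b k * \<nu> k * (u (Suc k) - u k)\<^sup>2 / (2 * \<kappa>)" for k
  proof -
    have "b k * \<nu> k > 0" using \<nu> b by simp
    from young_inequality_sqr[OF \<open>\<kappa> > 0\<close> this, of "S (Suc k)" "u (Suc k) - u k"]
    show ?thesis unfolding R_def .
  qed
  have "UP N \<le> S N * u N + (UP (Suc N) + R N * A) / 2 + EP N / (2 * \<kappa>)" for N
  proof -
    have "- (\<Sum>k<N. S (Suc k) * (u (Suc k) - u k))
        \<le> (\<Sum>k<N. \<kappa> / 2 * R k + b k * \<nu> k * (u (Suc k) - u k)\<^sup>2 / (2 * \<kappa>))"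
      unfolding sum_negf[symmetric] by (intro sum_mono young)
    also have "\<dots> = \<kappa> * (\<Sum>k<N. R k) / 2 + EP N / (2 * \<kappa>)"
      by (simp add: sum.distrib EP_def sum_distrib_left sum_divide_distrib)
    finally show ?thesis using hardy[of N] parts[of N] by (simp add: field_simps)
  qed
  moreover have "UP \<longlonglongrightarrow> U" "EP \<longlonglongrightarrow> E"
    using U E by (simp_all add: sums_def UP_def[abs_def] EP_def[abs_def])
  then have "(\<lambda>N. S N * u N + (UP (Suc N) + R N * A) / 2 + EP N / (2 * \<kappa>))
      \<longlonglongrightarrow> 0 + (U + 0 * A) / 2 + E / (2 * \<kappa>)"
    using R0 \<open>\<kappa> > 0\<close> unfolding R_def[symmetric]
    by (intro tendsto_intros Su) (auto intro: LIMSEQ_Suc)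
  ultimately have "U \<le> 0 + (U + 0 * A) / 2 + E / (2 * \<kappa>)"
    using \<open>UP \<longlonglongrightarrow> U\<close> by (intro LIMSEQ_le) auto
  then show ?thesis using \<open>\<kappa> > 0\<close> by (simp add: field_simps)
qed

section \<open>Stationary law and Poincare inequality of the queue\<close>

text \<open>The contribution of starting states in \<open>F\<close> to the mass at \<open>y\<close>
  never exceeds \<open>pmf \<nu> y\<close> and equals it at time 0, because \<open>y\<close> lies in
  \<open>F\<close>. So its right derivative at 0 cannot be positive. Working with a finite
  \<open>F\<close> avoids exchanging the derivative with an infinite sum, at the price of an
  inequality.\<close>

lemma stationary_generator_le:
  assumes ctmc: "ctmc q P" and stat: "stationary P \<nu>" and "finite F" "y \<in> F"
  shows "(\<Sum>x\<in>F. pmf \<nu> x * q x y) \<le> 0"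
proof (rule ccontr)
  assume "\<not> ?thesis"
  then have gt: "0 < (\<Sum>x\<in>F. pmf \<nu> x * q x y)" by simp
  define \<phi> where "\<phi> h = (\<Sum>x\<in>F. pmf \<nu> x * pmf (P h x) y)" for h
  have \<phi>0: "\<phi> 0 = pmf \<nu> y"
  proof -
    have "\<phi> 0 = (\<Sum>x\<in>F. if x = y then pmf \<nu> x else 0)"
      unfolding \<phi>_def using ctmc by (intro sum.cong) (auto simp: ctmc_def pmf_return indicator_def)
    then show ?thesis using \<open>finite F\<close> \<open>y \<in> F\<close> by simp
  qed
  have "\<phi> h \<le> pmf \<nu> y" if "h \<ge> 0" for h
  proof -
    have "pmf \<nu> y = pmf (bind_pmf \<nu> (P h)) y"
      using stat that by (simp add: stationary_def law_at_def)
    also have "\<dots> = measure_pmf.expectation \<nu> (\<lambda>x. pmf (P h x) y)"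
      by (rule pmf_bind)
    also have "\<dots> \<ge> measure_pmf.expectation \<nu> (\<lambda>x. indicator F x * pmf (P h x) y)"
      by (intro integral_mono expectation_bounded[where B = 1])
        (auto simp: pmf_le_1 split: split_indicator)
    also have "measure_pmf.expectation \<nu> (\<lambda>x. indicator F x * pmf (P h x) y) = \<phi> h"
      unfolding \<phi>_def
      by (subst integral_measure_pmf[OF \<open>finite F\<close>]) (auto simp: indicator_eq_0_iff)
    finally show ?thesis .
  qed
  moreover have "(\<phi> has_real_derivative (\<Sum>x\<in>F. pmf \<nu> x * q x y)) (at_right 0)"
    unfolding \<phi>_def using ctmc by (auto intro!: derivative_eq_intros simp: ctmc_def mult.commute)
  from has_real_derivative_pos_inc_right[OF this gt]
  obtain d where "d > 0" "\<And>h. 0 < h \<Longrightarrow> h < d \<Longrightarrow> \<phi> 0 < \<phi> h" by auto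
  from this(1) this(2)[of "d / 2"] have "\<phi> 0 < \<phi> (d / 2)" by simp
  ultimately show False using \<phi>0 \<open>d > 0\<close> by (metis half_gt_zero less_le_not_le)
qed

locale mmn_queue =
  fixes n :: nat and r :: real and P :: "real \<Rightarrow> nat \<Rightarrow> nat pmf" and \<nu> :: "nat pmf"
  assumes n: "n \<ge> 1" and r: "0 < r" "r < real n"
    and ctmc: "ctmc (mmn_generator n r) P" and stat: "stationary P \<nu>"
begin

abbreviation a :: "nat \<Rightarrow> real" where "a k \<equiv> real (min n k)"

abbreviation nbhd :: "nat \<Rightarrow> nat set" where "nbhd x \<equiv> {x - 1, x, x + 1}"

text \<open>At \<open>x = 0\<close> the truncated \<open>x - 1\<close> is \<open>x\<close> itself
  and the set has only two elements.\<close>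

lemma sum_nbhd:
  "(\<Sum>y\<in>nbhd x. h y) = (if x = 0 then 0 else h (x - 1)) + h x + h (x + 1)" for h :: "nat \<Rightarrow> real"
  by (cases x) auto

lemma bounded: "bounded_ctmc (mmn_generator n r) P nbhd (2 * (r + n))"
proof
  fix x
  show "(\<Sum>y\<in>nbhd x. mmn_generator n r x y) = 0"
    unfolding sum_nbhd by (auto simp: mmn_generator_def)
  show "(\<Sum>y\<in>nbhd x. \<bar>mmn_generator n r x y\<bar>) \<le> 2 * (r + n)"
    unfolding sum_nbhd using r by (auto simp: mmn_generator_def)
qed (use ctmc in auto)

sublocale bounded_ctmc "mmn_generator n r" P nbhd "2 * (r + n)"
  by (rule bounded)

lemma gen_eq: "gen v x = r * (v (Suc x) - v x) - a x * (v x - v (x - 1))"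
  unfolding gen_def sum_nbhd by (auto simp: mmn_generator_def algebra_simps)

lemma pmf_tendsto_0: "(\<lambda>k. pmf \<nu> k) \<longlonglongrightarrow> 0"
  using sums_expectation_nat[of "\<lambda>_. 1" 1 \<nu>] by (simp add: sums_iff summable_LIMSEQ_zero)

lemma detailed_balance: "r * pmf \<nu> k = a (Suc k) * pmf \<nu> (Suc k)"
proof -
  \<comment> \<open>Stationarity makes the net flow \<open>J\<close> increasing from \<open>J 0 \<ge> 0\<close>, and \<open>J\<close> tends to \<open>0\<close>.\<close>
  define J where "J k = r * pmf \<nu> k - a (Suc k) * pmf \<nu> (Suc k)" for k
  have J0: "J 0 \<ge> 0"
    using stationary_generator_le[OF ctmc stat, of "{0, 1}" 0]
    by (simp add: J_def mmn_generator_def algebra_simps)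
  have Jmono: "J k \<le> J (Suc k)" for k
    \<comment> \<open>These are all the states with a nonzero rate into
      \<open>Suc k\<close>.\<close>
    using stationary_generator_le[OF ctmc stat, of "{k, Suc k, Suc (Suc k)}" "Suc k"]
    by (simp add: J_def mmn_generator_def algebra_simps)
  then have inc: "incseq J" by (rule incseq_SucI)
  have "J \<longlonglongrightarrow> 0"
  proof (rule tendsto_sandwich[of "\<lambda>_. 0" J sequentially "\<lambda>k. r * pmf \<nu> k"])
    show "(\<lambda>k. r * pmf \<nu> k) \<longlonglongrightarrow> 0"
      using tendsto_mult_left[OF pmf_tendsto_0, of r] by simp
    show "\<forall>\<^sub>F k in sequentially. 0 \<le> J k"
      using J0 inc by (auto simp: incseq_def intro!: always_eventually order.trans[OF J0])
  qed (auto simp: J_def)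
  with inc have "J k \<le> 0" by (rule incseq_le)
  moreover have "0 \<le> J k" using J0 inc by (auto simp: incseq_def intro: order.trans)
  ultimately show ?thesis by (simp add: J_def)
qed

lemma pmf_pos: "pmf \<nu> k > 0"
proof -
  have step: "pmf \<nu> (Suc k) = 0 \<longleftrightarrow> pmf \<nu> k = 0" for k
    using detailed_balance[of k] n r by auto
  have "pmf \<nu> k \<noteq> 0"
  proof
    assume "pmf \<nu> k = 0"
    then have "pmf \<nu> 0 = 0" by (induction k) (auto simp: step)
    then have "pmf \<nu> j = 0" for j by (induction j) (auto simp: step)
    then show False using set_pmf_not_empty[of \<nu>] by (auto simp: set_pmf_iff)
  qed
  then show ?thesis by (simp add: less_le)
qed

lemma pmf_geometric: "n \<le> k \<Longrightarrow> pmf \<nu> (j + k) = pmf \<nu> k * (r / n) ^ j"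
proof (induction j)
  case (Suc j)
  have "pmf \<nu> (Suc (j + k)) = r / n * pmf \<nu> (j + k)"
    using detailed_balance[of "j + k"] n Suc.prems by (simp add: field_simps)
  then show ?case using Suc by simp
qed simp

text \<open>Mean 0 turns the partial sum into minus the tail, and from state \<open>n\<close> on the
  tail of \<nu> is geometric with ratio \<open>r / n\<close>.\<close>

lemma partial_sum_bound:
  assumes vB: "\<And>y. \<bar>v y\<bar> \<le> B" and mean: "measure_pmf.expectation \<nu> v = 0" and "n \<le> k"
  shows "\<bar>\<Sum>j<k. pmf \<nu> j * v j\<bar> \<le> pmf \<nu> k * (B / (1 - r / n))"
proof -
  have "(\<lambda>j. pmf \<nu> j * v j) sums 0"
    using sums_expectation_nat[of v B \<nu>, OF vB] mean by simp
  from sums_split_initial_segment[OF this, of k]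
  have tail: "(\<lambda>j. pmf \<nu> (j + k) * v (j + k)) sums (- (\<Sum>j<k. pmf \<nu> j * v j))" by simp
  have "r / n < 1" "0 < r / n" using r n by auto
  then have geo: "(\<lambda>j. pmf \<nu> k * (B * (r / n) ^ j)) sums (pmf \<nu> k * (B * (1 / (1 - r / n))))"
    by (intro sums_mult geometric_sums) auto
  have "\<bar>pmf \<nu> (j + k) * v (j + k)\<bar> \<le> pmf \<nu> k * (B * (r / n) ^ j)" for j
    using mult_left_mono[OF vB[of "j + k"], of "pmf \<nu> k * (r / n) ^ j"] \<open>0 < r / n\<close>
    by (simp add: pmf_geometric[OF \<open>n \<le> k\<close>] abs_mult mult_ac)
  then have "norm (\<Sum>j. pmf \<nu> (j + k) * v (j + k)) \<le> (\<Sum>j. pmf \<nu> k * (B * (r / n) ^ j))"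
    by (intro norm_suminf_le) (use geo in \<open>auto simp: sums_iff\<close>)
  then show ?thesis
    using tail geo by (simp add: sums_iff)
qed

lemma energy_summable:
  assumes vB: "\<And>y. \<bar>v y\<bar> \<le> B"
  shows "summable (\<lambda>k. r * pmf \<nu> k * (v (Suc k) - v k)\<^sup>2)"
proof (rule summable_comparison_test')
  show "summable (\<lambda>k. pmf \<nu> k * (r * (2 * B)\<^sup>2))"
    using sums_expectation_nat[of "\<lambda>_. 1" 1 \<nu>] by (intro summable_mult2) (simp add: sums_iff)
  have "(v (Suc k) - v k)\<^sup>2 \<le> (2 * B)\<^sup>2" for k
    using power_mono[of "\<bar>v (Suc k) - v k\<bar>" "2 * B" 2] vB[of k] vB[of "Suc k"] by auto
  then show "norm (r * pmf \<nu> k * (v (Suc k) - v k)\<^sup>2) \<le> pmf \<nu> k * (r * (2 * B)\<^sup>2)" for k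
    using r by (simp add: abs_mult mult_left_mono mult_ac)
qed

text \<open>With \<open>e\<close> the rate-weighted increments of \<open>v\<close>, detailed balance
  writes each summand as a telescoping difference minus the energy term. The telescoping part sums
  to 0, since \<open>e 0 = 0\<close> and \<open>v k * e k\<close> tends to 0.\<close>

lemma dirichlet_form:
  assumes vB: "\<And>y. \<bar>v y\<bar> \<le> B"
  shows "- measure_pmf.expectation \<nu> (\<lambda>x. v x * gen v x)
    = (\<Sum>k. r * pmf \<nu> k * (v (Suc k) - v k)\<^sup>2)"
proof -
  define E where "E k = r * pmf \<nu> k * (v (Suc k) - v k)\<^sup>2" for k
  define e where "e k = a k * pmf \<nu> k * (v k - v (k - 1))" for k
  define M where "M = 2 * (r + n) * B"
  have "\<bar>v x * gen v x\<bar> \<le> B * M" for x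
    unfolding M_def abs_mult using vB[of x] gen_bound[of v B x, OF vB]
    by (intro mult_mono) auto
  then have s1: "(\<lambda>k. pmf \<nu> k * (v k * gen v k)) sums measure_pmf.expectation \<nu> (\<lambda>x. v x * gen v x)"
    by (rule sums_expectation_nat)
  have e_Suc: "e (Suc k) = r * pmf \<nu> k * (v (Suc k) - v k)" for k
    unfolding e_def detailed_balance by simp
  have eq: "pmf \<nu> k * (v k * gen v k) = (v (Suc k) * e (Suc k) - v k * e k) - E k" for k
    unfolding e_Suc unfolding gen_eq E_def e_def by (simp add: algebra_simps power2_eq_square)
  have "(\<lambda>k. pmf \<nu> k * (n * (2 * B * B))) \<longlonglongrightarrow> 0"
    using tendsto_mult_right[OF pmf_tendsto_0, of "n * (2 * B * B)"] by simp
  then have "(\<lambda>k. v k * e k) \<longlonglongrightarrow> 0"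
  proof (rule Lim_null_comparison[rotated])
    have "\<bar>v k * e k\<bar> \<le> pmf \<nu> k * (n * (2 * B * B))" for k
    proof -
      have "\<bar>v k\<bar> * \<bar>v k - v (k - 1)\<bar> \<le> B * (2 * B)"
        using vB[of k] vB[of "k - 1"] by (intro mult_mono) auto
      then have "a k * (\<bar>v k\<bar> * \<bar>v k - v (k - 1)\<bar>) \<le> n * (B * (2 * B))"
        by (rule mult_mono[rotated]) auto
      from mult_left_mono[OF this pmf_nonneg[of \<nu> k]] show ?thesis
        by (simp add: e_def abs_mult mult_ac)
    qed
    then show "\<forall>\<^sub>F k in sequentially. norm (v k * e k) \<le> pmf \<nu> k * (n * (2 * B * B))" by simp
  qed
  from telescope_sums[OF this] have "(\<lambda>k. v (Suc k) * e (Suc k) - v k * e k) sums 0"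
    by (simp add: e_def)
  from sums_diff[OF this summable_sums[OF energy_summable[OF vB]]]
  have "(\<lambda>k. pmf \<nu> k * (v k * gen v k)) sums (0 - (\<Sum>k. E k))"
    unfolding eq by (simp add: E_def)
  with s1 show ?thesis by (simp add: sums_iff E_def)
qed

text \<open>Truncated subtraction makes the weights equal to 1 below \<open>n\<close>. There the gap
  comes from the growth of the death rates; from \<open>n\<close> on these are constant, and the
  drift towards \<open>n\<close> supplies it.\<close>

lemma poincare:
  assumes eps: "\<epsilon> > 0" and \<kappa>: "\<kappa> > 0" "\<kappa> \<le> 1 - r * \<epsilon>" "\<kappa> \<le> \<epsilon> * (n / (1 + \<epsilon>) - r)"
    and vB: "\<And>y. \<bar>v y\<bar> \<le> B" and mean: "measure_pmf.expectation \<nu> v = 0"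
  shows "\<kappa> * measure_pmf.expectation \<nu> (\<lambda>x. (v x)\<^sup>2) \<le> - measure_pmf.expectation \<nu> (\<lambda>x. v x * gen v x)"
  unfolding dirichlet_form[OF vB]
proof (rule birth_death_poincare[where \<nu> = "pmf \<nu>" and a = a and b = "\<lambda>_. r" and u = v
      and d = "\<lambda>k. (1 + \<epsilon>) ^ (Suc k - n)" and A = n])
  define C where "C = B / (1 - r / n)"
  define S where "S k = (\<Sum>j<k. pmf \<nu> j * v j)" for k
  have "r / n < 1" using r n by auto
  have "B \<ge> 0" using vB[of 0] by linarith
  then have "C \<ge> 0" using \<open>r / n < 1\<close> by (simp add: C_def)
  have S: "\<bar>S k\<bar> \<le> pmf \<nu> k * C" if "n \<le> k" for k
    unfolding S_def C_def by (rule partial_sum_bound[OF vB mean that])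
  show "r * pmf \<nu> k = a (Suc k) * pmf \<nu> (Suc k)" for k by (rule detailed_balance)
  show "\<kappa> * (1 + \<epsilon>) ^ (Suc k - n) \<le> (r + a (Suc k)) * (1 + \<epsilon>) ^ (Suc k - n)
      - a k * (1 + \<epsilon>) ^ (Suc (k - 1) - n) - r * (1 + \<epsilon>) ^ (Suc (Suc k) - n)" for k
  proof (cases "Suc k" n rule: linorder_cases)
    case less
    \<comment> \<open>All weights involved are 1, and the right-hand side is the increment of the
      death rate, which is 1.\<close>
    have "\<kappa> \<le> 1" using \<kappa>(2) r(1) eps by (smt (verit) mult_pos_pos)
    with less show ?thesis by (simp add: Suc_diff_le)
  next
    case equal
    \<comment> \<open>At \<open>k = n - 1\<close> only the next weight,
      \<open>1 + \<epsilon>\<close>, has begun to grow; this costs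
      \<open>r * \<epsilon>\<close>.\<close>
    have "Suc (k - 1) - n = 0" using equal by simp
    then show ?thesis using equal[symmetric] \<kappa>(2) by (simp add: algebra_simps)
  next
    case greater
    then obtain j where k: "k = n + j" by (metis less_Suc_eq_le le_Suc_ex)
    have "Suc (k - 1) = k" using k n by simp
    have "\<kappa> * (1 + \<epsilon>) \<le> \<epsilon> * (n - r * (1 + \<epsilon>))"
      using \<kappa>(3) eps by (simp add: field_simps)
    then have "(1 + \<epsilon>) ^ j * (\<kappa> * (1 + \<epsilon>)) \<le> (1 + \<epsilon>) ^ j * (\<epsilon> * (n - r * (1 + \<epsilon>)))"
      using eps by (intro mult_left_mono) auto
    then show ?thesis
      using \<open>Suc (k - 1) = k\<close> by (simp add: k Suc_diff_le algebra_simps)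
  qed
  show "a k * (1 + \<epsilon>) ^ (Suc (k - 1) - n) \<le> n * (1 + \<epsilon>) ^ (Suc k - n)" for k
    using eps by (intro mult_mono power_increasing) auto
  show "(\<lambda>k. (\<Sum>j<Suc k. pmf \<nu> j * v j)\<^sup>2 / (r * pmf \<nu> k)) \<longlonglongrightarrow> 0"
    unfolding S_def[symmetric]
  proof (rule Lim_null_comparison)
    show "(\<lambda>k. pmf \<nu> k * (r * C\<^sup>2 / n\<^sup>2)) \<longlonglongrightarrow> 0"
      using tendsto_mult_right[OF pmf_tendsto_0, of "r * C\<^sup>2 / n\<^sup>2"] by simp
    \<comment> \<open>The square supplies two factors of order \<open>pmf \<nu> k\<close>; one
      cancels the denominator and the other tends to 0.\<close>
    have "(S (Suc k))\<^sup>2 / (r * pmf \<nu> k) \<le> pmf \<nu> k * (r * C\<^sup>2 / n\<^sup>2)" if "k \<ge> n" for k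
    proof -
      have "(S (Suc k))\<^sup>2 \<le> (pmf \<nu> (Suc k) * C)\<^sup>2"
        using power_mono[OF S[of "Suc k"], of 2] that by simp
      also have "pmf \<nu> (Suc k) = pmf \<nu> k * (r / n)"
        using pmf_geometric[OF that, of 1] by simp
      finally show ?thesis
        using pmf_pos[of k] r n by (simp add: pos_divide_le_eq power2_eq_square field_simps)
    qed
    then show "\<forall>\<^sub>F k in sequentially. norm ((S (Suc k))\<^sup>2 / (r * pmf \<nu> k)) \<le> pmf \<nu> k * (r * C\<^sup>2 / n\<^sup>2)"
      using r by (auto simp: eventually_sequentially)
  qed
  show "(\<lambda>k. (\<Sum>j<k. pmf \<nu> j * v j) * v k) \<longlonglongrightarrow> 0"
    unfolding S_def[symmetric]
  proof (rule Lim_null_comparison)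
    show "(\<lambda>k. pmf \<nu> k * (C * B)) \<longlonglongrightarrow> 0"
      using tendsto_mult_right[OF pmf_tendsto_0, of "C * B"] by simp
    have "\<bar>S k * v k\<bar> \<le> pmf \<nu> k * (C * B)" if "k \<ge> n" for k
      using mult_mono[OF S[OF that] vB[of k]] \<open>C \<ge> 0\<close> by (simp add: abs_mult mult.assoc)
    then show "\<forall>\<^sub>F k in sequentially. norm (S k * v k) \<le> pmf \<nu> k * (C * B)"
      by (auto simp: eventually_sequentially)
  qed
  have "\<bar>(v y)\<^sup>2\<bar> \<le> B\<^sup>2" for y
    using power_mono[OF vB abs_ge_zero, of y 2] by simp
  then show "(\<lambda>k. pmf \<nu> k * (v k)\<^sup>2) sums measure_pmf.expectation \<nu> (\<lambda>x. (v x)\<^sup>2)"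
    by (rule sums_expectation_nat)
  show "(\<lambda>k. r * pmf \<nu> k * (v (Suc k) - v k)\<^sup>2) sums (\<Sum>k. r * pmf \<nu> k * (v (Suc k) - v k)\<^sup>2)"
    by (intro summable_sums energy_summable[OF vB])
qed (use pmf_pos r eps \<kappa> in auto)

lemma chi_decay:
  assumes "\<epsilon> > 0" "\<kappa> > 0" "\<kappa> \<le> 1 - r * \<epsilon>" "\<kappa> \<le> \<epsilon> * (n / (1 + \<epsilon>) - r)" and "t \<ge> 0"
  shows "chi (law_at P \<pi> t) \<nu> \<le> ennreal (exp (- \<kappa> * t)) * chi \<pi> \<nu>"
proof (rule chi_le_of_chi_sq_le)
  have "chi_sq (law_at P \<pi> t) \<nu> \<le> ennreal (exp (- 2 * \<kappa> * t)) * chi_sq \<pi> \<nu>"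
    by (rule chi_sq_decay[OF bounded stat pmf_pos poincare[OF assms(1-4)] \<open>t \<ge> 0\<close>])
  then show "chi_sq (law_at P \<pi> t) \<nu> \<le> ennreal ((exp (- \<kappa> * t))\<^sup>2) * chi_sq \<pi> \<nu>"
    by (simp add: mult_ac flip: exp_double)
qed

end

section \<open>The decay rate and its limit\<close>

text \<open>
  The second branch only matters for the finitely many \<open>n\<close> at which the first value is not
  positive; it uses a smaller \<open>\<epsilon>\<close> in place of \<open>1 / n\<close>.
\<close>
definition gap_bound :: "nat \<Rightarrow> real \<Rightarrow> real" where
  "gap_bound n r = (let l = real n / (real n + 1) - r / n; \<epsilon> = min 1 (n - r) / (2 * r)
    in if l > 0 then l else min (1 / 2) (\<epsilon> * (n / (1 + \<epsilon>) - r)))"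

lemma gap_bound_witness:
  assumes "n \<ge> 1" "0 < r" "r < real n"
  shows "gap_bound n r > 0 \<and> (\<exists>\<epsilon>>0. gap_bound n r \<le> 1 - r * \<epsilon> \<and> gap_bound n r \<le> \<epsilon> * (n / (1 + \<epsilon>) - r))"
proof (cases "real n / (real n + 1) - r / n > 0")
  case True
  \<comment> \<open>With \<open>\<epsilon> = 1 / n\<close> the second bound is an equality; this
    estimate gives the first one, \<open>1 - r / n\<close>.\<close>
  have "real n / (real n + 1) \<le> 1" by simp
  moreover have "1 / real n * (n / (1 + 1 / n) - r) = real n / (real n + 1) - r / n"
    using assms by (simp add: field_simps)
  ultimately show ?thesis
    using True assms by (intro conjI exI[of _ "1 / real n"]) (auto simp: gap_bound_def)
next
  case False
  define \<epsilon> where "\<epsilon> = min 1 (n - r) / (2 * r)"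
  have "\<epsilon> > 0" using assms by (simp add: \<epsilon>_def)
  \<comment> \<open>The first bound is then at least \<open>1 / 2\<close>, and
    \<open>r * (1 + \<epsilon>)\<close> uses up at most half of the distance from \<open>r\<close>
    to \<open>n\<close>, which keeps the second one positive.\<close>
  have re: "r * \<epsilon> = min 1 (n - r) / 2" using assms by (simp add: \<epsilon>_def)
  have "r * (1 + \<epsilon>) < n" using re assms by (simp add: algebra_simps min_def split: if_splits)
  then have "r < n / (1 + \<epsilon>)" using \<open>\<epsilon> > 0\<close> by (simp add: pos_less_divide_eq)
  moreover have "r * \<epsilon> \<le> 1 / 2" using re by simp
  moreover have "gap_bound n r = min (1 / 2) (\<epsilon> * (n / (1 + \<epsilon>) - r))"
    using False unfolding gap_bound_def Let_def \<epsilon>_def by simp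
  ultimately show ?thesis
    using \<open>\<epsilon> > 0\<close> by (intro conjI exI[of _ \<epsilon>]) auto
qed

lemma gap_bound_tendsto:
  assumes "c < 1" and lim: "(\<lambda>n. lam n / real n) \<longlonglongrightarrow> c"
  shows "(\<lambda>n. gap_bound n (lam n)) \<longlonglongrightarrow> 1 - c"
proof -
  have "(\<lambda>n. real n / (real n + 1) - lam n / n) \<longlonglongrightarrow> 1 - c"
    using LIMSEQ_n_over_Suc_n by (intro tendsto_diff lim) (simp add: add.commute)
  \<comment> \<open>The limit \<open>1 - c\<close> is positive, so the first branch eventually
    applies.\<close>
  moreover from order_tendstoD(1)[OF this, of 0] \<open>c < 1\<close>
  have "\<forall>\<^sub>F n in sequentially. real n / (real n + 1) - lam n / n = gap_bound n (lam n)"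
    by (auto simp: gap_bound_def elim!: eventually_mono)
  ultimately show ?thesis by (rule Lim_transform_eventually)
qed

theorem proposition4:
  fixes c :: real and lam :: "nat \<Rightarrow> real"
    and P :: "nat \<Rightarrow> real \<Rightarrow> nat \<Rightarrow> nat pmf" and \<nu> :: "nat \<Rightarrow> nat pmf"
  assumes "0 \<le> c" and "c < 1"
    and "\<And>n. n \<ge> 1 \<Longrightarrow> 0 < lam n \<and> lam n < real n"
    and "(\<lambda>n. lam n / real n) \<longlonglongrightarrow> c"
    and "\<And>n. n \<ge> 1 \<Longrightarrow> ctmc (mmn_generator n (lam n)) (P n)"
    and "\<And>n. n \<ge> 1 \<Longrightarrow> stationary (P n) (\<nu> n)"
  shows "\<exists>L :: nat \<Rightarrow> real.
           (\<forall>n\<ge>1. L n > 0) \<and> L \<longlonglongrightarrow> 1 - c \<and>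
           (\<forall>n\<ge>1. \<forall>\<pi>\<^sub>0 :: nat pmf. \<forall>t\<ge>0.
              chi (law_at (P n) \<pi>\<^sub>0 t) (\<nu> n) \<le> ennreal (exp (- L n * t)) * chi \<pi>\<^sub>0 (\<nu> n))"
proof (intro exI conjI allI impI)
  fix n :: nat assume "n \<ge> 1"
  note wit = gap_bound_witness[of n "lam n"] assms(3)[OF \<open>n \<ge> 1\<close>] \<open>n \<ge> 1\<close>
  \<comment> \<open>This fixes the witness for \<open>L\<close>; it is built from \<open>n\<close>
    and \<open>lam n\<close> alone.\<close>
  then show "gap_bound n (lam n) > 0" by blast
  interpret mmn_queue n "lam n" "P n" "\<nu> n"
    by standard (use assms \<open>n \<ge> 1\<close> in auto)
  show "chi (law_at (P n) \<pi>\<^sub>0 t) (\<nu> n) \<le> ennreal (exp (- gap_bound n (lam n) * t)) * chi \<pi>\<^sub>0 (\<nu> n)"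
    if "t \<ge> 0" for \<pi>\<^sub>0 t
    using wit chi_decay that by blast
qed (rule gap_bound_tendsto[OF assms(2,4)])

end
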